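(* Let $G=(V,E)$ be a finite graph with a fixed orientation, let $q\geq 2$, and let $\partial:\mathbb{Z}_q^E\to\mathbb{Z}_q^V$ be the boundary map. Let $t$ be an indeterminate. (i) If $s\in\mathbb{C}$ satisfies $s^q\neq 1$, then $$X_q(G;1,s,\ldots,s^{q-1};t)=q^{-|E|}(t-1)^{|E|}\sum_{y\in\mathbb{Z}_q^E}\Big(\frac{t-1+q}{t-1}\Big)^{|E|-|y|}\prod_{v\in V}\frac{s^q-1}{s\,e^{2\pi i(\partial y)_v/q}-1}.$$ (ii) If $s=e^{-2\pi i c/q}$ for some $c\in\{0,1,\ldots,q-1\}$, then $$X_q(G;1,e^{-2\pi ic/q},\ldots,e^{-2\pi i(q-1)c/q};t)=q^{|V|-|E|}(t-1)^{|E|}\sum_{\substack{y\in\mathbb{Z}_q^E\\ (\partial y)_v=c\ \forall v\in V}}\Big(\frac{t-1+q}{t-1}\Big)^{|E|-|y|}.$$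
   Context: For $s_0,\ldots,s_{q-1},t$, $$X_q(G;s_0,\ldots,s_{q-1};t)=\sum_{x\in\{0,1,\ldots,q-1\}^V}t^{\#\{uv\in E:\,x_u=x_v\}}\prod_{a=0}^{q-1}s_a^{\#\{v\in V:x_v=a\}}$$ (a loop counts as a monochromatic edge). With the orientation encoded by $\sigma_{v,e}=+1$ if $e$ is directed into $v$, $-1$ if out of $v$, $0$ if $v\notin e$, $(\partial y)_v=\sum_e\sigma_{v,e}y_e\in\mathbb{Z}_q$, and $e^{2\pi i a/q}$ is well defined for $a\in\mathbb{Z}_q$. The Hamming weight is $|y|=\#\{e\in E:y_e\neq 0\}$. *)

theory Defs
  imports
    Complex_Main
    "HOL-Library.FuncSet"
    "HOL-Computational_Algebra.Polynomial"
    "HOL-Computational_Algebra.Fraction_Field"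
begin

text \<open>Finite undirected graphs, with loops and parallel edges allowed: an edge \<open>e\<close> has
  the set \<open>ends e\<close> of one (loop) or two endpoints.\<close>

locale finite_multigraph =
  fixes V :: "'v set" and E :: "'e set" and ends :: "'e \<Rightarrow> 'v set"
  assumes finite_verts: "finite V"
    and finite_edges: "finite E"
    and ends_subset: "e \<in> E \<Longrightarrow> ends e \<subseteq> V"
    and card_ends: "e \<in> E \<Longrightarrow> card (ends e) \<in> {1, 2}"

locale oriented_multigraph = finite_multigraph V E ends
  for V :: "'v set" and E :: "'e set" and ends :: "'e \<Rightarrow> 'v set" +
  fixes tail head :: "'e \<Rightarrow> 'v"
  assumes ends_orientation: "e \<in> E \<Longrightarrow> ends e = {tail e, head e}"

definition monochromatic :: "('e \<Rightarrow> 'v set) \<Rightarrow> ('v \<Rightarrow> nat) \<Rightarrow> 'e \<Rightarrow> bool" where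
  "monochromatic ends x e \<longleftrightarrow> (\<forall>u\<in>ends e. \<forall>w\<in>ends e. x u = x w)"

definition X_poly ::
  "nat \<Rightarrow> 'v set \<Rightarrow> 'e set \<Rightarrow> ('e \<Rightarrow> 'v set) \<Rightarrow> (nat \<Rightarrow> 'a) \<Rightarrow> 'a \<Rightarrow> 'a :: comm_semiring_1" where
  "X_poly q V E ends s t =
     (\<Sum>x \<in> V \<rightarrow>\<^sub>E {0..<q}.
        t ^ card {e \<in> E. monochromatic ends x e} * (\<Prod>a<q. s a ^ card {v \<in> V. x v = a}))"

text \<open>The group of integers modulo \<open>q\<close> is represented by the residues \<open>0, \<dots>, q - 1\<close>.\<close>

definition Zq :: "nat \<Rightarrow> int set" where
  "Zq q = {0..<int q}"

text \<open>A loop is directed both into and out of its vertex; its two contributions cancel, so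
  its incidence number is \<open>0\<close>.\<close>

definition incidence_sign :: "('e \<Rightarrow> 'v) \<Rightarrow> ('e \<Rightarrow> 'v) \<Rightarrow> 'v \<Rightarrow> 'e \<Rightarrow> int" where
  "incidence_sign tail head v e = of_bool (head e = v) - of_bool (tail e = v)"

definition boundary ::
  "nat \<Rightarrow> 'v set \<Rightarrow> 'e set \<Rightarrow> ('e \<Rightarrow> 'v) \<Rightarrow> ('e \<Rightarrow> 'v) \<Rightarrow> ('e \<Rightarrow> int) \<Rightarrow> 'v \<Rightarrow> int" where
  "boundary q V E tail head y =
     (\<lambda>v\<in>V. (\<Sum>e\<in>E. incidence_sign tail head v e * y e) mod int q)"

lemma boundary_in_Zq:
  assumes "q > 0"
  shows "boundary q V E tail head \<in> (E \<rightarrow>\<^sub>E Zq q) \<rightarrow> (V \<rightarrow>\<^sub>E Zq q)"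
  using assms by (auto simp: boundary_def Zq_def)

definition hamming_weight :: "'e set \<Rightarrow> ('e \<Rightarrow> int) \<Rightarrow> nat" where
  "hamming_weight E y = card {e \<in> E. y e \<noteq> 0}"

text \<open>The identities live in the field of rational functions over the complex numbers, in which
  \<open>emb\<close> embeds the constants and \<open>indet\<close> is the indeterminate.\<close>

definition emb :: "complex \<Rightarrow> complex poly fract" where
  "emb c = Fraction_Field.Fract [:c:] 1"

definition indet :: "complex poly fract" where
  "indet = Fraction_Field.Fract [:0, 1:] 1"

end

theory Submission
  imports Defs "HOL-Analysis.Complex_Transcendental"
begin

text \<open>Expand the weight of each edge in additive characters of \<open>\<int>\<^sub>q\<close>: with \<open>d = x (head e) - x (tail e)\<close>
  and \<open>\<omega> = exp (2 \<pi> \<i> / q)\<close>, the sum of \<open>\<omega> ^ (j * d)\<close> over \<open>j\<close>, weighted by \<open>t - 1 + q\<close> at \<open>j = 0\<close> and by \<open>t - 1\<close>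
  elsewhere, is \<open>q * t\<close> if \<open>d = 0\<close> and \<open>q\<close> otherwise. Multiplying over the edges introduces
  the sum over \<open>y\<close>, summation by parts turns the characters of the differences into characters of
  \<open>x v * \<partial>y v\<close>, and the sum over colourings \<open>x\<close> then factors over the vertices into geometric sums.\<close>

section \<open>Additive characters of the integers modulo \<open>q\<close>\<close>

definition root_char :: "nat \<Rightarrow> int \<Rightarrow> complex" where
  "root_char q k = exp (2 * of_real pi * \<i> * of_int k / of_nat q)"

lemma root_char_0 [simp]: "root_char q 0 = 1"
  by (simp add: root_char_def)

lemma root_char_add: "root_char q (j + k) = root_char q j * root_char q k"
  by (simp add: root_char_def distrib_left add_divide_distrib flip: exp_add)

lemma root_char_sum: "root_char q (\<Sum>i\<in>I. f i) = (\<Prod>i\<in>I. root_char q (f i))"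
  by (induction I rule: infinite_finite_induct) (simp_all add: root_char_add)

lemma root_char_mult_nat: "root_char q (int n * k) = root_char q k ^ n"
  by (induction n) (simp_all add: distrib_right root_char_add)

lemma root_char_eq_1_iff:
  assumes "q > 0"
  shows "root_char q k = 1 \<longleftrightarrow> int q dvd k"
proof -
  have "root_char q k = 1 \<longleftrightarrow> (\<exists>n::int. 2 * pi * of_int k / of_nat q = of_int (2 * n) * pi)"
    by (simp add: root_char_def exp_eq_1)
  also have "\<dots> \<longleftrightarrow> (\<exists>n::int. real_of_int k = of_int (int q * n))"
    using assms by (simp add: field_simps)
  also have "\<dots> \<longleftrightarrow> int q dvd k"
    unfolding of_int_eq_iff by (auto simp: dvd_def)
  finally show ?thesis .
qed

lemma root_char_power_order:
  assumes "q > 0"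
  shows "root_char q k ^ q = 1"
  using assms by (simp add: root_char_eq_1_iff flip: root_char_mult_nat)

text \<open>The character has period \<open>q\<close>. Hence the reduction built into
  \<open>boundary\<close> can be undone inside a character, and integer identities apply
  there.\<close>

lemma root_char_mult_mod:
  assumes "q > 0"
  shows "root_char q (a * (k mod int q)) = root_char q (a * k)"
proof -
  have "root_char q (a * k) = root_char q (a * (k mod int q) + int q * (a * (k div int q)))"
    by (metis mod_mult_div_eq distrib_left mult.left_commute)
  also have "\<dots> = root_char q (a * (k mod int q))"
    using assms by (simp add: root_char_add root_char_eq_1_iff)
  finally show ?thesis by simp
qed

text \<open>Orthogonality of characters: this is a geometric sum whose ratio is a
  \<open>q\<close>-th root of unity, so either the ratio is 1 or the numerator of the closed form
  vanishes.\<close>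

lemma sum_root_char:
  assumes "q > 0"
  shows "(\<Sum>a<q. root_char q (int a * k)) = (if int q dvd k then of_nat q else 0)"
proof (cases "int q dvd k")
  case True
  then have "root_char q (int a * k) = 1" for a
    using assms by (simp add: root_char_eq_1_iff)
  then show ?thesis
    using True by simp
next
  case False
  then have "root_char q k \<noteq> 1"
    using assms by (simp add: root_char_eq_1_iff)
  then show ?thesis
    using False assms by (simp add: root_char_mult_nat geometric_sum root_char_power_order)
qed

lemma sum_Zq: "(\<Sum>j\<in>Zq q. f j) = (\<Sum>a<q. f (int a))"
  unfolding Zq_def
  by (rule sum.reindex_bij_witness[where i = int and j = nat]) auto

lemma emb_0 [simp]: "emb 0 = 0"
  by (simp add: emb_def Zero_fract_def)

lemma emb_1 [simp]: "emb 1 = 1"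
  by (simp add: emb_def One_fract_def one_pCons)

lemma emb_add: "emb (a + b) = emb a + emb b"
  by (simp add: emb_def)

lemma emb_mult: "emb (a * b) = emb a * emb b"
  by (simp add: emb_def mult.commute)

lemma emb_sum: "emb (\<Sum>i\<in>I. f i) = (\<Sum>i\<in>I. emb (f i))"
  by (induction I rule: infinite_finite_induct) (simp_all add: emb_add)

lemma emb_prod: "emb (\<Prod>i\<in>I. f i) = (\<Prod>i\<in>I. emb (f i))"
  by (induction I rule: infinite_finite_induct) (simp_all add: emb_mult)

lemma emb_of_nat [simp]: "emb (of_nat n) = of_nat n"
  by (induction n) (simp_all add: emb_add)

text \<open>The field has characteristic zero, which allows the powers of \<open>q\<close> to be
  cancelled in the final formulas.\<close>

lemma of_nat_poly_fract_eq_0_iff [simp]: "(of_nat n :: complex poly fract) = 0 \<longleftrightarrow> n = 0"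
  by (simp add: of_nat_fract Zero_fract_def eq_fract)

lemma indet_neq_1: "indet \<noteq> 1"
  by (simp add: indet_def One_fract_def eq_fract one_pCons)

section \<open>Vertex weights and the Fourier expansion of one edge\<close>

lemma prod_eq_prod_power_card:
  fixes s :: "nat \<Rightarrow> 'a :: comm_semiring_1"
  assumes "finite V" and "x \<in> V \<rightarrow> {0..<q}"
  shows "(\<Prod>a<q. s a ^ card {v \<in> V. x v = a}) = (\<Prod>v\<in>V. s (x v))"
proof -
  have "(\<Prod>a<q. s a ^ card {v \<in> V. x v = a}) = (\<Prod>a<q. \<Prod>v\<in>{v \<in> V. x v = a}. s (x v))"
    by (intro prod.cong) simp_all
  \<comment> \<open>The colour classes for \<open>a < q\<close> partition \<open>V\<close>, since
    \<open>x\<close> takes its values below \<open>q\<close>.\<close>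
  also have "\<dots> = (\<Prod>v\<in>V. s (x v))"
    using assms by (intro prod.group) auto
  finally show ?thesis .
qed

lemma prod_if_eq_power_card:
  fixes b c :: "'a :: comm_monoid_mult"
  assumes "finite E"
  shows "(\<Prod>e\<in>E. if P e then b else c) = b ^ card {e \<in> E. P e} * c ^ card {e \<in> E. \<not> P e}"
  using assms by (simp add: prod.If_cases Int_def Collect_neg_eq[symmetric])

text \<open>Fourier inversion: the coefficients are the constant \<open>t - 1\<close> plus a spike
  of height \<open>q\<close> at \<open>j = 0\<close>. The constant part contributes
  \<open>(t - 1) * q\<close> exactly when \<open>a = b\<close>, by orthogonality, and the spike
  always contributes \<open>q\<close>.\<close>

lemma edge_weight_expansion:
  fixes a b q :: nat
  assumes "a < q" "b < q"
  shows "of_nat q * (if a = b then t else 1) =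
    (\<Sum>j\<in>Zq q. (if j = 0 then t - 1 + of_nat q else t - 1) * emb (root_char q (j * (int a - int b))))"
proof -
  have q: "q > 0" using assms by simp
  \<comment> \<open>Both colours lie below \<open>q\<close>, so congruence modulo \<open>q\<close>
    is equality.\<close>
  have dvd: "int q dvd int a - int b \<longleftrightarrow> a = b"
    using assms by (auto simp: mod_eq_dvd_iff[symmetric])
  have "(\<Sum>j\<in>Zq q. (if j = 0 then t - 1 + of_nat q else t - 1) * emb (root_char q (j * (int a - int b))))
    = (\<Sum>j\<in>Zq q. (t - 1) * emb (root_char q (j * (int a - int b))) + (if j = 0 then of_nat q else 0))"
    by (intro sum.cong) (auto simp: algebra_simps)
  also have "\<dots> = (t - 1) * emb (\<Sum>j\<in>Zq q. root_char q (j * (int a - int b))) + of_nat q"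
    using q by (simp add: sum.distrib sum_distrib_left emb_sum Zq_def)
  also have "\<dots> = (t - 1) * (if a = b then of_nat q else 0) + of_nat q"
    using q by (simp add: sum_Zq sum_root_char dvd)
  also have "\<dots> = of_nat q * (if a = b then t else 1)"
    by (simp add: algebra_simps)
  finally show ?thesis by simp
qed

section \<open>Edge expansion of the graph polynomial\<close>

context oriented_multigraph
begin

lemma head_in_verts: "e \<in> E \<Longrightarrow> head e \<in> V"
  and tail_in_verts: "e \<in> E \<Longrightarrow> tail e \<in> V"
  using ends_orientation ends_subset by blast+

lemma monochromatic_iff: "e \<in> E \<Longrightarrow> monochromatic ends x e \<longleftrightarrow> x (head e) = x (tail e)"
  by (auto simp: monochromatic_def ends_orientation)

text \<open>The coboundary is adjoint to the boundary. For a fixed edge only its head and its tail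
  contribute, and for a loop the two contributions cancel.\<close>

lemma sum_by_parts_boundary:
  fixes x :: "'v \<Rightarrow> int"
  shows "(\<Sum>e\<in>E. y e * (x (head e) - x (tail e))) =
    (\<Sum>v\<in>V. x v * (\<Sum>e\<in>E. incidence_sign tail head v e * y e))"
proof -
  have "(\<Sum>v\<in>V. x v * (incidence_sign tail head v e * y e)) = y e * (x (head e) - x (tail e))"
    if "e \<in> E" for e
  proof -
    have "(\<Sum>v\<in>V. x v * (incidence_sign tail head v e * y e)) =
      y e * ((\<Sum>v\<in>V. if head e = v then x v else 0) - (\<Sum>v\<in>V. if tail e = v then x v else 0))"
      unfolding sum_subtractf[symmetric] sum_distrib_left
      by (intro sum.cong) (auto simp: incidence_sign_def)
    also have "\<dots> = y e * (x (head e) - x (tail e))"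
      using that by (simp add: finite_verts head_in_verts tail_in_verts)
    finally show ?thesis .
  qed
  then have "(\<Sum>e\<in>E. y e * (x (head e) - x (tail e))) =
      (\<Sum>e\<in>E. \<Sum>v\<in>V. x v * (incidence_sign tail head v e * y e))"
    by simp
  also have "\<dots> = (\<Sum>v\<in>V. \<Sum>e\<in>E. x v * (incidence_sign tail head v e * y e))"
    by (rule sum.swap)
  finally show ?thesis
    by (simp add: sum_distrib_left)
qed

lemma prod_root_char_boundary:
  assumes "q > 0"
  shows "(\<Prod>e\<in>E. root_char q (y e * (int (x (head e)) - int (x (tail e))))) =
    (\<Prod>v\<in>V. root_char q (int (x v) * boundary q V E tail head y v))"
proof -
  have "(\<Prod>e\<in>E. root_char q (y e * (int (x (head e)) - int (x (tail e))))) =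
    (\<Prod>v\<in>V. root_char q (int (x v) * (\<Sum>e\<in>E. incidence_sign tail head v e * y e)))"
    by (simp only: sum_by_parts_boundary[of y "\<lambda>v. int (x v)"] flip: root_char_sum)
  also have "\<dots> = (\<Prod>v\<in>V. root_char q (int (x v) * boundary q V E tail head y v))"
    using assms by (intro prod.cong) (simp_all add: boundary_def root_char_mult_mod)
  finally show ?thesis .
qed

text \<open>Exactly \<open>card E - hamming_weight E y\<close> edges carry the value 0. Taking
  \<open>t - 1\<close> out of every factor leaves the quotient on these edges and 1 on the
  others.\<close>

lemma prod_edge_coefficient:
  fixes t :: "'a :: field"
  assumes "t \<noteq> 1"
  shows "(\<Prod>e\<in>E. if y e = 0 then t - 1 + of_nat q else t - 1) =
    (t - 1) ^ card E * ((t - 1 + of_nat q) / (t - 1)) ^ (card E - hamming_weight E y)"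
proof -
  let ?Z = "{e \<in> E. y e = 0}"
  have "?Z = E - {e \<in> E. y e \<noteq> 0}"
    by auto
  then have card_Z: "card ?Z = card E - hamming_weight E y"
    by (simp add: hamming_weight_def card_Diff_subset finite_edges)
  \<comment> \<open>This makes the subtraction of natural numbers in the exponent exact.\<close>
  have "hamming_weight E y \<le> card E"
    unfolding hamming_weight_def by (intro card_mono finite_edges) auto
  then have card_E: "card E = card ?Z + hamming_weight E y"
    using card_Z by simp
  have "(\<Prod>e\<in>E. if y e = 0 then t - 1 + of_nat q else t - 1) =
      (t - 1 + of_nat q) ^ card ?Z * (t - 1) ^ hamming_weight E y"
    by (simp add: prod_if_eq_power_card finite_edges hamming_weight_def)
  also have "\<dots> = (t - 1) ^ card E * ((t - 1 + of_nat q) / (t - 1)) ^ card ?Z"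
    using assms by (simp add: card_E power_add power_divide)
  finally show ?thesis
    by (simp only: card_Z)
qed

text \<open>The common source of both identities. The vertex weights \<open>s\<close> stay
  arbitrary, so that each case only has to evaluate the sum at a single vertex.\<close>

lemma X_poly_edge_expansion:
  assumes "q > 0" "t \<noteq> 1"
  shows "of_nat q ^ card E * X_poly q V E ends (\<lambda>a. emb (s a)) t =
    (t - 1) ^ card E *
    (\<Sum>y \<in> E \<rightarrow>\<^sub>E Zq q. ((t - 1 + of_nat q) / (t - 1)) ^ (card E - hamming_weight E y) *
      emb (\<Prod>v\<in>V. \<Sum>a<q. s a * root_char q (int a * boundary q V E tail head y v)))"
proof -
  define c where "c j = (if j = 0 then t - 1 + of_nat q else t - 1)" for j :: int
  let ?bd = "boundary q V E tail head"
  have finite_Zq: "finite (Zq q)"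
    by (simp add: Zq_def)
  have colouring: "of_nat q ^ card E * (t ^ card {e \<in> E. monochromatic ends x e} *
        (\<Prod>a<q. emb (s a) ^ card {v \<in> V. x v = a})) =
      (\<Sum>y \<in> E \<rightarrow>\<^sub>E Zq q. (\<Prod>e\<in>E. c (y e)) *
        emb (\<Prod>v\<in>V. s (x v) * root_char q (int (x v) * ?bd y v)))"
    if x: "x \<in> V \<rightarrow>\<^sub>E {0..<q}" for x
  proof -
    have x_less: "x v < q" if "v \<in> V" for v
      using x that by auto
    have "of_nat q ^ card E * t ^ card {e \<in> E. monochromatic ends x e} =
        (\<Prod>e\<in>E. of_nat q * (if monochromatic ends x e then t else 1))"
      by (simp add: prod.distrib prod_if_eq_power_card finite_edges)
    also have "\<dots> = (\<Prod>e\<in>E. \<Sum>j\<in>Zq q. c j * emb (root_char q (j * (int (x (head e)) - int (x (tail e))))))"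
      unfolding c_def
      by (intro prod.cong refl) (simp only: monochromatic_iff edge_weight_expansion x_less head_in_verts tail_in_verts)
    \<comment> \<open>By distributivity, choosing one \<open>j\<close> for every edge is choosing
      one \<open>y\<close>. The characters of the edges are then regrouped at the vertices.\<close>
    also have "\<dots> = (\<Sum>y \<in> E \<rightarrow>\<^sub>E Zq q. (\<Prod>e\<in>E. c (y e)) *
        emb (\<Prod>v\<in>V. root_char q (int (x v) * ?bd y v)))"
      by (simp add: prod_sum_PiE finite_edges finite_Zq prod.distrib assms(1)
          flip: prod_root_char_boundary emb_prod)
    finally have edges: "of_nat q ^ card E * t ^ card {e \<in> E. monochromatic ends x e} = \<dots>" .
    have "(\<Prod>a<q. emb (s a) ^ card {v \<in> V. x v = a}) = emb (\<Prod>v\<in>V. s (x v))"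
      using x by (subst prod_eq_prod_power_card) (auto simp: finite_verts emb_prod)
    then show ?thesis
      unfolding mult.assoc[symmetric] edges
      by (simp add: sum_distrib_left prod.distrib emb_mult mult_ac)
  qed
  have "of_nat q ^ card E * X_poly q V E ends (\<lambda>a. emb (s a)) t =
      (\<Sum>x \<in> V \<rightarrow>\<^sub>E {0..<q}. \<Sum>y \<in> E \<rightarrow>\<^sub>E Zq q. (\<Prod>e\<in>E. c (y e)) *
        emb (\<Prod>v\<in>V. s (x v) * root_char q (int (x v) * ?bd y v)))"
    unfolding X_poly_def sum_distrib_left by (intro sum.cong refl colouring)
  also have "\<dots> = (\<Sum>y \<in> E \<rightarrow>\<^sub>E Zq q. (\<Prod>e\<in>E. c (y e)) *
      emb (\<Sum>x \<in> V \<rightarrow>\<^sub>E {0..<q}. \<Prod>v\<in>V. s (x v) * root_char q (int (x v) * ?bd y v)))"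
    by (subst sum.swap) (simp add: emb_sum sum_distrib_left)
  \<comment> \<open>Distributivity in the other direction: for fixed \<open>y\<close> the summand is
    a product over vertices, so the colours can be summed independently.\<close>
  also have "\<dots> = (\<Sum>y \<in> E \<rightarrow>\<^sub>E Zq q. (\<Prod>e\<in>E. c (y e)) *
      emb (\<Prod>v\<in>V. \<Sum>a<q. s a * root_char q (int a * ?bd y v)))"
    by (simp add: prod_sum_PiE finite_verts atLeast0LessThan)
  finally show ?thesis
    unfolding c_def prod_edge_coefficient[OF assms(2)]
    by (simp add: sum_distrib_left mult.assoc)
qed

end

section \<open>Evaluation of the vertex sums and the two identities\<close>

lemma sum_power_root_char:
  assumes "q > 0" "s ^ q \<noteq> 1"
  shows "(\<Sum>a<q. s ^ a * root_char q (int a * k)) = (s ^ q - 1) / (s * root_char q k - 1)"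
proof -
  \<comment> \<open>The \<open>q\<close>-th power removes the root of unity, so
    \<open>s ^ q \<noteq> 1\<close> keeps the ratio of the geometric sum away from 1.\<close>
  have pow: "(s * root_char q k) ^ q = s ^ q"
    using assms(1) by (simp add: power_mult_distrib root_char_power_order)
  then have "s * root_char q k \<noteq> 1"
    using assms(2) by auto
  then have "(\<Sum>a<q. (s * root_char q k) ^ a) = (s ^ q - 1) / (s * root_char q k - 1)"
    by (simp add: geometric_sum pow)
  then show ?thesis
    by (simp add: root_char_mult_nat power_mult_distrib)
qed

theorem theorem3p9:
  fixes V :: "'v set" and E :: "'e set" and ends :: "'e \<Rightarrow> 'v set"
    and tail head :: "'e \<Rightarrow> 'v" and q :: nat
  assumes "oriented_multigraph V E ends tail head"
    and "q \<ge> 2"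
  shows
    "(\<forall>s::complex. s ^ q \<noteq> 1 \<longrightarrow>
        X_poly q V E ends (\<lambda>a. emb (s ^ a)) indet =
          of_nat q powi (- int (card E)) * (indet - 1) ^ card E *
          (\<Sum>y \<in> E \<rightarrow>\<^sub>E Zq q.
             ((indet - 1 + of_nat q) / (indet - 1)) ^ (card E - hamming_weight E y) *
             emb (\<Prod>v\<in>V. (s ^ q - 1) /
               (s * exp (2 * of_real pi * \<i> * of_int (boundary q V E tail head y v) / of_nat q) - 1))))
     \<and>
     (\<forall>c\<in>{0..<q}.
        X_poly q V E ends (\<lambda>a. emb (exp (- (2 * of_real pi * \<i> * of_nat (a * c) / of_nat q)))) indet =
          of_nat q powi (int (card V) - int (card E)) * (indet - 1) ^ card E *
          (\<Sum>y \<in> {y \<in> E \<rightarrow>\<^sub>E Zq q. \<forall>v\<in>V. boundary q V E tail head y v = int c}.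
             ((indet - 1 + of_nat q) / (indet - 1)) ^ (card E - hamming_weight E y)))"
proof -
  interpret oriented_multigraph V E ends tail head by fact
  have q: "q > 0"
    using assms(2) by simp
  note expansion = X_poly_edge_expansion[OF q indet_neq_1]
  show ?thesis
  proof (intro conjI allI impI ballI)
    fix s :: complex
    assume s: "s ^ q \<noteq> 1"
    show "X_poly q V E ends (\<lambda>a. emb (s ^ a)) indet =
          of_nat q powi (- int (card E)) * (indet - 1) ^ card E *
          (\<Sum>y \<in> E \<rightarrow>\<^sub>E Zq q.
             ((indet - 1 + of_nat q) / (indet - 1)) ^ (card E - hamming_weight E y) *
             emb (\<Prod>v\<in>V. (s ^ q - 1) /
               (s * exp (2 * of_real pi * \<i> * of_int (boundary q V E tail head y v) / of_nat q) - 1)))"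
      (is "?X = _ * _ ^ _ * ?S")
    proof -
      have "of_nat q ^ card E * ?X = (indet - 1) ^ card E * ?S"
        unfolding expansion sum_power_root_char[OF q s] by (simp only: root_char_def)
      then show ?thesis
        using q by (simp add: power_int_minus field_simps)
    qed
  next
    fix c
    assume c: "c \<in> {0..<q}"
    let ?f = "\<lambda>a. exp (- (2 * of_real pi * \<i> * of_nat (a * c) / of_nat q)) :: complex"
    let ?Y = "{y \<in> E \<rightarrow>\<^sub>E Zq q. \<forall>v\<in>V. boundary q V E tail head y v = int c}"
    let ?w = "\<lambda>y. ((indet - 1 + of_nat q) / (indet - 1)) ^ (card E - hamming_weight E y)"
    have vertex: "(\<Sum>a<q. ?f a * root_char q (int a * boundary q V E tail head y v)) =
        (if boundary q V E tail head y v = int c then of_nat q else 0)" if "v \<in> V" for y v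
    proof -
      let ?b = "boundary q V E tail head y v"
      \<comment> \<open>The vertex weight is itself a character. Multiplying by it shifts the
        boundary value by \<open>- c\<close>, and orthogonality then detects whether that value is
        \<open>c\<close>.\<close>
      have "?f a = root_char q (int a * (- int c))" for a
        by (simp add: root_char_def)
      then have "(\<Sum>a<q. ?f a * root_char q (int a * ?b)) = (\<Sum>a<q. root_char q (int a * (?b - int c)))"
        by (simp add: algebra_simps flip: root_char_add)
      \<comment> \<open>Both numbers are residues below \<open>q\<close>: the boundary is reduced
        and \<open>c < q\<close>.\<close>
      moreover have "int q dvd ?b - int c \<longleftrightarrow> ?b = int c"
        using that c by (auto simp: boundary_def mod_eq_dvd_iff[symmetric])
      ultimately show ?thesis
        using q by (simp add: sum_root_char)
    qed
    have all_vertices: "(\<Prod>v\<in>V. \<Sum>a<q. ?f a * root_char q (int a * boundary q V E tail head y v)) =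
        (if \<forall>v\<in>V. boundary q V E tail head y v = int c then of_nat q ^ card V else 0)" for y
    proof -
      have "(\<Prod>v\<in>V. \<Sum>a<q. ?f a * root_char q (int a * boundary q V E tail head y v)) =
          (\<Prod>v\<in>V. if boundary q V E tail head y v = int c then of_nat q else 0)"
        by (intro prod.cong refl vertex)
      also have "\<dots> = (if \<forall>v\<in>V. boundary q V E tail head y v = int c then of_nat q ^ card V else 0)"
        by (auto simp: finite_verts)
      finally show ?thesis .
    qed
    have "of_nat q ^ card E * X_poly q V E ends (\<lambda>a. emb (?f a)) indet =
        (indet - 1) ^ card E * (\<Sum>y \<in> E \<rightarrow>\<^sub>E Zq q. ?w y *
          (if \<forall>v\<in>V. boundary q V E tail head y v = int c then of_nat q ^ card V else 0))"
      unfolding expansion all_vertices by (simp add: if_distrib[of emb] flip: of_nat_power cong: if_cong)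
    also have "\<dots> = (indet - 1) ^ card E * (of_nat q ^ card V * (\<Sum>y \<in> ?Y. ?w y))"
    proof -
      have "finite (E \<rightarrow>\<^sub>E Zq q)"
        by (intro finite_PiE finite_edges) (simp add: Zq_def)
      then show ?thesis
        by (simp add: sum_distrib_left sum.inter_filter if_distrib mult.commute cong: if_cong)
    qed
    \<comment> \<open>Dividing by \<open>q ^ card E\<close> leaves an exponent that may be negative,
      hence the integer power.\<close>
    finally show "X_poly q V E ends (\<lambda>a. emb (?f a)) indet =
        of_nat q powi (int (card V) - int (card E)) * (indet - 1) ^ card E * (\<Sum>y \<in> ?Y. ?w y)"
      using q by (simp add: power_int_diff field_simps)
  qed
qed

end
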